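(* Sample-specific calibration is optimal among the class $\mathcal C$, with improved asymptotic variance over the non-calibrated estimator. That is, for every $f$ with $P_0f^{\otimes2}<\infty$, the estimator $\mathbb P_N^{\mathrm{H,sc}}f$ of $P_0f$ has the smallest asymptotic variance among all estimators in $\mathcal C$, and $$\mathrm{AV}(\mathbb G_N^{\mathrm{H,sc}}f)=\mathrm{AV}(\mathbb G_N^{\mathrm H}f)-\sum_{j=1}^J\nu^{(j)}\frac{1-p^{(j)}}{p^{(j)}}\mathrm{Var}_0^{(j)}\left(Q_{\mathrm{sc}}^{(j)}f\right),$$ where $$Q_{\mathrm{sc}}^{(j)}(f)[v]=P_0^{(j)}\left\{\rho^{(j)}(V)f(X)\big(\rho^{(j)}(V)V-P_0^{(j)}\rho^{(j)}(V)V\big)^T\right\}\left\{\mathrm{Var}_0^{(j)}\big(\rho^{(j)}(V)V\big)\right\}^{-1}\left\{\rho^{(j)}(v)v-P_0^{(j)}\rho^{(j)}(V)V\right\}I\{v\in\mathcal V^{(j)}\}.$$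
   Context: Setting. $X$ takes values in a measurable space $(\mathcal{X},\mathcal{A})$ and has law $P_0$. $U\in\mathcal U$ is a vector of auxiliary variables, $W=(X,U)$ has law $\tilde P_0$, and $V=(\check X,U)\in\mathcal V\subset\mathbb R^k$, where $\check X$ is a coarsening (measurable function) of $X$. $\mathcal V=\bigcup_{j=1}^J\mathcal V^{(j)}$ is a union of $J$ measurable, possibly overlapping data sources. $\nu^{(j)}=\tilde P_0(V\in\mathcal V^{(j)})$, $P_0^{(j)}$ is the conditional law of $W$ given $V\in\mathcal V^{(j)}$; $\mathrm{Var}_0,\mathrm{Var}_0^{(j)}$ are variances under $P_0,P_0^{(j)}$. $a^{\otimes2}=aa^T$; $Qf=\int f\,dQ$. Sampling. $W_1,\dots,W_N$ are i.i.d. copies of $W$ with corresponding $X_i,V_i$; $N^{(j)}=\#\{i\le N:V_i\in\mathcal V^{(j)}\}$. From each source $j$ a simple random sample of size $n^{(j)}\le N^{(j)}$ is drawn without replacement from the units with $V_i\in\mathcal V^{(j)}$, independently across sources given the data; $R_i^{(j)}$ is the selection indicator ($0$ if $V_i\notin\mathcal V^{(j)}$); $\pi^{(j)}(V_i)=(n^{(j)}/N^{(j)})I\{V_i\in\mathcal V^{(j)}\}$, convention $0/0=0$; $n^{(j)}/N^{(j)}\to p^{(j)}\ge c>0$ as $N\to\infty$. $V_i$ is available for all $N$ units. Weight function. $\rho=(\rho^{(1)},\dots,\rho^{(J)}):\mathcal V\to[0,1]^J$ is fixed, constant on each of the disjoint regions of $\mathcal V$ determined by which of the sources contain $v$, with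 $\rho^{(j)}(v)=0$ if $v\notin\mathcal V^{(j)}$, $\rho^{(j)}(v)=1$ if $v$ belongs to $\mathcal V^{(j)}$ only, and $\sum_{j}\rho^{(j)}(v)=1$. Non-calibrated estimator: $\mathbb P_N^{\mathrm H}f=\frac1N\sum_{i=1}^N\sum_{j=1}^J\frac{R_i^{(j)}\rho^{(j)}(V_i)}{\pi^{(j)}(V_i)}f(X_i)$, $\mathbb G_N^{\mathrm H}f=\sqrt N(\mathbb P_N^{\mathrm H}f-P_0f)$. Sample-specific calibration: with $\mathbb P^{(j)}_{N^{(j)}}f=\frac1{N^{(j)}}\sum_{i:V_i\in\mathcal V^{(j)}}f(X_i,V_i)$ and $G^{(j)}_\alpha(v)=G\big[\{\rho^{(j)}(v)v-\mathbb P^{(j)}_{N^{(j)}}\rho^{(j)}(V)V\}^T\alpha^{(j)}\big]$, $\hat\alpha_N^{\mathrm{sc}}=(\hat\alpha_N^{\mathrm{sc},(1)},\dots,\hat\alpha_N^{\mathrm{sc},(J)})$ solves $\frac1{N^{(j)}}\sum_{i:V_i\in\mathcal V^{(j)}}\frac{R_i^{(j)}G^{(j)}_{\alpha^{(j)}}(V_i)}{\pi^{(j)}(V_i)}\{\rho^{(j)}(V_i)V_i-\mathbb P^{(j)}_{N^{(j)}}\rho^{(j)}(V)V\}=0$, $j=1,\dots,J$; then $\mathbb P_N^{\mathrm{H,sc}}f=\frac1N\sum_{i=1}^N\sum_{j=1}^J\frac{R_i^{(j)}\rho^{(j)}(V_i)}{\pi^{(j)}(V_i)}G^{(j)}_{\hat\alpha_N^{\mathrm{sc},(j)}}(V_i)f(X_i)$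 and $\mathbb G_N^{\mathrm{H,sc}}f=\sqrt N(\mathbb P_N^{\mathrm{H,sc}}f-P_0f)$. Standing assumptions for calibration: a solution $\hat\alpha_N^{\mathrm{sc}}$ of the sample-specific calibration equations $\frac1{N^{(j)}}\sum_{i:V_i\in\mathcal V^{(j)}}\frac{R_i^{(j)}G^{(j)}_{\alpha^{(j)}}(V_i)}{\pi^{(j)}(V_i)}\{\rho^{(j)}(V_i)V_i-\mathbb P^{(j)}_{N^{(j)}}\rho^{(j)}(V)V\}=0$, $j=1,\dots,J$ (and a solution $\hat\alpha_N^{\mathrm c}$ of the calibration equation $\mathbb P_N^{\mathrm H}G(V^T\alpha)V=\frac1N\sum_{i=1}^NV_i$) exist; $V$ has bounded support with $\mathcal V^{(j)}\ne\{0\}$ for all $j$; $G$ is a strictly increasing, continuously differentiable, bounded function on $\mathbb R$ with $G(0)=1$ and with strictly positive bounded derivative; $\tilde P_0V^{\otimes2}$ and every $\mathrm{Var}_0^{(j)}\{\rho^{(j)}(V)V\}$ with $P_0^{(j)}\rho^{(j)}(V)>0$ are finite and positive definite. Class $\mathcal C$: the class of estimators of $P_0f$, for arbitrary $f$ with $P_0f^{\otimes2}<\infty$, whose asymptotic variance (after centering at $P_0f$ and scaling by $\sqrt N$) has the form $$\mathrm{Var}_0\{f(X)\}+\sum_{j=1}^J\nu^{(j)}\frac{1-p^{(j)}}{p^{(j)}}\mathrm{Var}_0^{(j)}\left[\rho^{(j)}(V)f(X)-L_f^{(j)}\{\rho^{(j)}(V)V\}\right],$$ where $L_f^{(j)}(v)$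 is a linear function of $v$ depending on $f$ (estimators with $Q^{(j)}_{\mathrm{sc}}(f)[v]$ in place of $L_f^{(j)}\{\rho^{(j)}(v)v\}$ are included; the additive constant is immaterial for the variance). $\mathrm{AV}(\cdot)$ denotes asymptotic variance, i.e. the variance of the weak limit; for $\mathbb G_N^{\mathrm H}f$ it is equal to $$\mathrm{AV}(\mathbb G_N^{\mathrm H}f)=\mathrm{Var}_0\{f(X)\}+\sum_{j=1}^J\nu^{(j)}\frac{1-p^{(j)}}{p^{(j)}}\mathrm{Var}_0^{(j)}\left[\rho^{(j)}(V)f(X)\right],$$ and for $\mathbb G_N^{\mathrm{H,sc}}f$ it is equal to $$\mathrm{AV}(\mathbb G_N^{\mathrm{H,sc}}f)=\mathrm{Var}_0\{f(X)\}+\sum_{j=1}^J\nu^{(j)}\frac{1-p^{(j)}}{p^{(j)}}\mathrm{Var}_0^{(j)}\left[\rho^{(j)}(V)f(X)-Q^{(j)}_{\mathrm{sc}}(f)[V]\right].$$ *)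

theory Defs
  imports "HOL-Probability.Probability"
begin

section \<open>Covariance matrices, Loewner order, asymptotic variance\<close>

text \<open>\<open>outer a b\<close> is $a b^T$; in particular \<open>outer a a\<close> is $a^{\otimes 2}$.\<close>

definition outer :: "real^'m \<Rightarrow> real^'n \<Rightarrow> real^'n^'m" where
  "outer a b = (\<chi> i j. a $ i * b $ j)"

definition cov_mat :: "'a measure \<Rightarrow> ('a \<Rightarrow> real^'n) \<Rightarrow> real^'n^'n" where
  "cov_mat Q h = (\<integral>x. outer (h x - (\<integral>y. h y \<partial>Q)) (h x - (\<integral>y. h y \<partial>Q)) \<partial>Q)"

definition pos_semidef :: "real^'n^'n \<Rightarrow> bool" where
  "pos_semidef A \<longleftrightarrow> transpose A = A \<and> (\<forall>x. 0 \<le> x \<bullet> (A *v x))"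

definition pos_def :: "real^'n^'n \<Rightarrow> bool" where
  "pos_def A \<longleftrightarrow> transpose A = A \<and> (\<forall>x. x \<noteq> 0 \<longrightarrow> 0 < x \<bullet> (A *v x))"

definition loewner_le :: "real^'n^'n \<Rightarrow> real^'n^'n \<Rightarrow> bool" where
  "loewner_le A B \<longleftrightarrow> pos_semidef (B - A)"

text \<open>The library's weak convergence is only for laws on the real line.\<close>

definition weak_limit :: "'w measure \<Rightarrow> (nat \<Rightarrow> 'w \<Rightarrow> real^'d) \<Rightarrow> (real^'d) measure \<Rightarrow> bool" where
  "weak_limit M Z \<mu> \<longleftrightarrow>
     (\<forall>N. Z N \<in> borel_measurable M) \<and> prob_space \<mu> \<and> sets \<mu> = sets borel \<and>
     (\<forall>g :: real^'d \<Rightarrow> real. continuous_on UNIV g \<and> bounded (range g) \<longrightarrow>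
        (\<lambda>N. \<integral>\<omega>. g (Z N \<omega>) \<partial>M) \<longlonglongrightarrow> (\<integral>z. g z \<partial>\<mu>))"

definition has_asymp_var ::
  "'w measure \<Rightarrow> (nat \<Rightarrow> 'w \<Rightarrow> real^'d) \<Rightarrow> real^'d^'d \<Rightarrow> bool" where
  "has_asymp_var M Z \<Sigma> \<longleftrightarrow>
     (\<exists>\<mu>. weak_limit M Z \<mu> \<and> integrable \<mu> (\<lambda>z. outer z z) \<and> \<Sigma> = cov_mat \<mu> (\<lambda>z. z))"

definition AV :: "'w measure \<Rightarrow> (nat \<Rightarrow> 'w \<Rightarrow> real^'d) \<Rightarrow> real^'d^'d" where
  "AV M Z = (THE \<Sigma>. has_asymp_var M Z \<Sigma>)"

text \<open>Centering and scaling of a sequence of estimators of \<open>\<theta>\<close>: $\sqrt N (T_N - \theta)$.\<close>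

definition rootn_err :: "(nat \<Rightarrow> 'w \<Rightarrow> real^'d) \<Rightarrow> real^'d \<Rightarrow> nat \<Rightarrow> 'w \<Rightarrow> real^'d" where
  "rootn_err T \<theta> N \<omega> = sqrt (real N) *\<^sub>R (T N \<omega> - \<theta>)"


section \<open>Merged data from overlapping sources\<close>

text \<open>
  \<^item> \<open>Om\<close> is the probability space carrying all units and all samples, \<open>Xsp\<close> the measurable
    space of \<open>X\<close>, and \<open>law\<close> the law of \<open>W = (X, U)\<close>.
  \<^item> \<open>coarsen\<close> maps \<open>X\<close> to its coarsening; \<open>src j\<close> is the region of data source \<open>j\<close>
    (the sources are indexed by a finite type), and \<open>rho j\<close> the weight of source \<open>j\<close>.
  \<^item> \<open>Wu i\<close> is \<open>W\<close> for unit \<open>i\<close>; the first \<open>N\<close> units are \<open>0, ..., N - 1\<close>.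
  \<^item> \<open>nsel N j\<close> is the (data dependent) sample size in source \<open>j\<close>, \<open>sel N j\<close> the set of
    selected units, and \<open>plim j\<close> the limiting sampling fraction.
\<close>

record ('w, 'x, 'c::finite, 'u::finite, 'j::finite) merged =
  Om :: "'w measure"
  Xsp :: "'x measure"
  law :: "('x \<times> (real^'u)) measure"
  coarsen :: "'x \<Rightarrow> real^'c"
  src :: "'j \<Rightarrow> (real^('c + 'u)) set"
  rho :: "'j \<Rightarrow> real^('c + 'u) \<Rightarrow> real"
  Wu :: "nat \<Rightarrow> 'w \<Rightarrow> 'x \<times> (real^'u)"
  nsel :: "nat \<Rightarrow> 'j \<Rightarrow> 'w \<Rightarrow> nat"
  sel :: "nat \<Rightarrow> 'j \<Rightarrow> 'w \<Rightarrow> nat set"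
  plim :: "'j \<Rightarrow> real"

definition join_vec :: "real^'c \<Rightarrow> real^'u \<Rightarrow> real^('c + 'u)" where
  "join_vec a b = (\<chi> k. case k of Inl i \<Rightarrow> a $ i | Inr i \<Rightarrow> b $ i)"

definition Vof :: "('w, 'x, 'c::finite, 'u::finite, 'j::finite) merged \<Rightarrow>
    'x \<times> (real^'u) \<Rightarrow> real^('c + 'u)" where
  "Vof D w = join_vec (coarsen D (fst w)) (snd w)"

definition P0 :: "('w, 'x, 'c::finite, 'u::finite, 'j::finite) merged \<Rightarrow> 'x measure" where
  "P0 D = distr (law D) (Xsp D) fst"

definition in_src :: "('w, 'x, 'c::finite, 'u::finite, 'j::finite) merged \<Rightarrow> 'j \<Rightarrow>
    ('x \<times> (real^'u)) set" where
  "in_src D j = {w \<in> space (law D). Vof D w \<in> src D j}"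

definition nu :: "('w, 'x, 'c::finite, 'u::finite, 'j::finite) merged \<Rightarrow> 'j \<Rightarrow> real" where
  "nu D j = measure (law D) (in_src D j)"

definition P0j :: "('w, 'x, 'c::finite, 'u::finite, 'j::finite) merged \<Rightarrow> 'j \<Rightarrow>
    ('x \<times> (real^'u)) measure" where
  "P0j D j = uniform_measure (law D) (in_src D j)"

definition units :: "('w, 'x, 'c::finite, 'u::finite, 'j::finite) merged \<Rightarrow> nat \<Rightarrow> 'j \<Rightarrow>
    'w \<Rightarrow> nat set" where
  "units D N j \<omega> = {i. i < N \<and> Vof D (Wu D i \<omega>) \<in> src D j}"

definition Nsrc :: "('w, 'x, 'c::finite, 'u::finite, 'j::finite) merged \<Rightarrow> nat \<Rightarrow> 'j \<Rightarrow>
    'w \<Rightarrow> nat" where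
  "Nsrc D N j \<omega> = card (units D N j \<omega>)"

definition Rind :: "('w, 'x, 'c::finite, 'u::finite, 'j::finite) merged \<Rightarrow> nat \<Rightarrow> 'j \<Rightarrow>
    nat \<Rightarrow> 'w \<Rightarrow> real" where
  "Rind D N j i \<omega> = indicator (sel D N j \<omega>) i"

definition samp_prob :: "('w, 'x, 'c::finite, 'u::finite, 'j::finite) merged \<Rightarrow> nat \<Rightarrow> 'j \<Rightarrow>
    'w \<Rightarrow> real^('c + 'u) \<Rightarrow> real" where
  "samp_prob D N j \<omega> v =
     real (nsel D N j \<omega>) / real (Nsrc D N j \<omega>) * indicator (src D j) v"

text \<open>The sigma-algebra generated by \<open>W\<close> of the first \<open>N\<close> units.\<close>

definition data_alg :: "('w, 'x, 'c::finite, 'u::finite, 'j::finite) merged \<Rightarrow> nat \<Rightarrow>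
    'w measure" where
  "data_alg D N = vimage_algebra (space (Om D)) (\<lambda>\<omega>. \<lambda>i\<in>{..<N}. Wu D i \<omega>)
     (PiM {..<N} (\<lambda>_. law D))"

text \<open>The conjunct on \<open>real_cond_exp\<close> is simple random sampling without replacement within each
  source, independently across sources given the data. The last conjunct is convergence in
  probability of the sampling fractions.\<close>

definition sampling_model ::
  "('w, 'x, 'c::finite, 'u::finite, 'j::finite) merged \<Rightarrow> bool" where
  "sampling_model D \<longleftrightarrow>
     prob_space (Om D) \<and>
     prob_space (law D) \<and> sets (law D) = sets (Xsp D \<Otimes>\<^sub>M borel) \<and>
     coarsen D \<in> borel_measurable (Xsp D) \<and>
     (\<forall>j. src D j \<in> sets borel) \<and>
     (AE w in law D. Vof D w \<in> (\<Union>j. src D j)) \<and>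
     prob_space.indep_vars (Om D) (\<lambda>_. law D) (Wu D) UNIV \<and>
     (\<forall>i. distr (Om D) (law D) (Wu D i) = law D) \<and>
     (\<forall>N j. sel D N j \<in> measurable (Om D) (count_space (Pow {..<N}))) \<and>
     (\<forall>N j. nsel D N j \<in> measurable (data_alg D N) (count_space UNIV)) \<and>
     (\<forall>N j. AE \<omega> in Om D. nsel D N j \<omega> \<le> Nsrc D N j \<omega>) \<and>
     (\<forall>N s. AE \<omega> in Om D.
        real_cond_exp (Om D) (data_alg D N) (\<lambda>\<omega>'. of_bool (\<forall>j. sel D N j \<omega>' = s j)) \<omega> =
        (\<Prod>j\<in>UNIV. of_bool (s j \<subseteq> units D N j \<omega> \<and> card (s j) = nsel D N j \<omega>) /
           real (Nsrc D N j \<omega> choose nsel D N j \<omega>))) \<and>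
     (\<exists>c>0. \<forall>j. c \<le> plim D j) \<and>
     (\<forall>j. \<forall>\<epsilon>>0. (\<lambda>N. measure (Om D) {\<omega> \<in> space (Om D).
        \<bar>real (nsel D N j \<omega>) / real (Nsrc D N j \<omega>) - plim D j\<bar> > \<epsilon>}) \<longlonglongrightarrow> 0)"

definition weight_function ::
  "('w, 'x, 'c::finite, 'u::finite, 'j::finite) merged \<Rightarrow> bool" where
  "weight_function D \<longleftrightarrow>
     (\<forall>j v. 0 \<le> rho D j v \<and> rho D j v \<le> 1) \<and>
     (\<forall>v\<in>(\<Union>j. src D j). \<forall>v'\<in>(\<Union>j. src D j).
        {j. v \<in> src D j} = {j. v' \<in> src D j} \<longrightarrow> (\<forall>j. rho D j v = rho D j v')) \<and>
     (\<forall>j v. v \<notin> src D j \<longrightarrow> rho D j v = 0) \<and>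
     (\<forall>j v. {j'. v \<in> src D j'} = {j} \<longrightarrow> rho D j v = 1) \<and>
     (\<forall>v\<in>(\<Union>j. src D j). (\<Sum>j\<in>UNIV. rho D j v) = 1)"

definition rhoV :: "('w, 'x, 'c::finite, 'u::finite, 'j::finite) merged \<Rightarrow> 'j \<Rightarrow>
    'x \<times> (real^'u) \<Rightarrow> real^('c + 'u)" where
  "rhoV D j w = rho D j (Vof D w) *\<^sub>R Vof D w"


section \<open>Estimators\<close>

text \<open>The non-calibrated estimator, for functions of \<open>W\<close>; functions \<open>f\<close> of \<open>X\<close> enter as
  \<open>f \<circ> fst\<close>.\<close>

definition PH :: "('w, 'x, 'c::finite, 'u::finite, 'j::finite) merged \<Rightarrow>
    ('x \<times> (real^'u) \<Rightarrow> real^'d) \<Rightarrow> nat \<Rightarrow> 'w \<Rightarrow> real^'d" where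
  "PH D h N \<omega> = (1 / real N) *\<^sub>R (\<Sum>i<N. \<Sum>j\<in>UNIV.
     (Rind D N j i \<omega> * rho D j (Vof D (Wu D i \<omega>)) / samp_prob D N j \<omega> (Vof D (Wu D i \<omega>)))
       *\<^sub>R h (Wu D i \<omega>))"

definition Psrc :: "('w, 'x, 'c::finite, 'u::finite, 'j::finite) merged \<Rightarrow> nat \<Rightarrow> 'j \<Rightarrow> 'w \<Rightarrow>
    ('x \<times> (real^'u) \<Rightarrow> real^'d) \<Rightarrow> real^'d" where
  "Psrc D N j \<omega> h = (1 / real (Nsrc D N j \<omega>)) *\<^sub>R (\<Sum>i\<in>units D N j \<omega>. h (Wu D i \<omega>))"

definition Gsc :: "('w, 'x, 'c::finite, 'u::finite, 'j::finite) merged \<Rightarrow> (real \<Rightarrow> real) \<Rightarrow>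
    nat \<Rightarrow> 'j \<Rightarrow> 'w \<Rightarrow> real^('c + 'u) \<Rightarrow> real^('c + 'u) \<Rightarrow> real" where
  "Gsc D G N j \<omega> a v = G ((rho D j v *\<^sub>R v - Psrc D N j \<omega> (rhoV D j)) \<bullet> a)"

definition sc_equations :: "('w, 'x, 'c::finite, 'u::finite, 'j::finite) merged \<Rightarrow>
    (real \<Rightarrow> real) \<Rightarrow> nat \<Rightarrow> ('j \<Rightarrow> real^('c + 'u)) \<Rightarrow> 'w \<Rightarrow> bool" where
  "sc_equations D G N a \<omega> \<longleftrightarrow> (\<forall>j. (1 / real (Nsrc D N j \<omega>)) *\<^sub>R (\<Sum>i\<in>units D N j \<omega>.
     (Rind D N j i \<omega> * Gsc D G N j \<omega> (a j) (Vof D (Wu D i \<omega>)) /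
        samp_prob D N j \<omega> (Vof D (Wu D i \<omega>)))
       *\<^sub>R (rhoV D j (Wu D i \<omega>) - Psrc D N j \<omega> (rhoV D j))) = 0)"

definition cal_equation :: "('w, 'x, 'c::finite, 'u::finite, 'j::finite) merged \<Rightarrow>
    (real \<Rightarrow> real) \<Rightarrow> nat \<Rightarrow> real^('c + 'u) \<Rightarrow> 'w \<Rightarrow> bool" where
  "cal_equation D G N a \<omega> \<longleftrightarrow>
     PH D (\<lambda>w. G (Vof D w \<bullet> a) *\<^sub>R Vof D w) N \<omega> =
     (1 / real N) *\<^sub>R (\<Sum>i<N. Vof D (Wu D i \<omega>))"

definition PHsc :: "('w, 'x, 'c::finite, 'u::finite, 'j::finite) merged \<Rightarrow> (real \<Rightarrow> real) \<Rightarrow>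
    (nat \<Rightarrow> 'j \<Rightarrow> 'w \<Rightarrow> real^('c + 'u)) \<Rightarrow> ('x \<Rightarrow> real^'d) \<Rightarrow> nat \<Rightarrow> 'w \<Rightarrow> real^'d" where
  "PHsc D G \<alpha> f N \<omega> = (1 / real N) *\<^sub>R (\<Sum>i<N. \<Sum>j\<in>UNIV.
     (Rind D N j i \<omega> * rho D j (Vof D (Wu D i \<omega>)) / samp_prob D N j \<omega> (Vof D (Wu D i \<omega>))
        * Gsc D G N j \<omega> (\<alpha> N j \<omega>) (Vof D (Wu D i \<omega>)))
       *\<^sub>R f (fst (Wu D i \<omega>)))"

text \<open>\<open>\<alpha> N j\<close> is the sample-specific calibration coefficient of source \<open>j\<close>, and \<open>\<beta> N\<close> the
  coefficient for the plain calibration equation. Existence of solutions is only required with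
  probability tending to one: for small \<open>N\<close> the equations need not be solvable. The integrability
  statements express finiteness of the second moment matrices.\<close>

definition calibration_assumptions ::
  "('w, 'x, 'c::finite, 'u::finite, 'j::finite) merged \<Rightarrow> (real \<Rightarrow> real) \<Rightarrow>
   (nat \<Rightarrow> 'j \<Rightarrow> 'w \<Rightarrow> real^('c + 'u)) \<Rightarrow> (nat \<Rightarrow> 'w \<Rightarrow> real^('c + 'u)) \<Rightarrow> bool" where
  "calibration_assumptions D G \<alpha> \<beta> \<longleftrightarrow>
     (\<forall>N j. \<alpha> N j \<in> borel_measurable (Om D)) \<and>
     (\<lambda>N. measure (Om D) {\<omega> \<in> space (Om D). sc_equations D G N (\<lambda>j. \<alpha> N j \<omega>) \<omega>}) \<longlonglongrightarrow> 1 \<and>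
     (\<forall>N. \<beta> N \<in> borel_measurable (Om D)) \<and>
     (\<lambda>N. measure (Om D) {\<omega> \<in> space (Om D). cal_equation D G N (\<beta> N \<omega>) \<omega>}) \<longlonglongrightarrow> 1 \<and>
     (\<exists>B. AE w in law D. norm (Vof D w) \<le> B) \<and>
     (\<forall>j. src D j \<noteq> {0}) \<and>
     strict_mono G \<and> bounded (range G) \<and> G 0 = 1 \<and>
     (\<exists>G'. (\<forall>x. (G has_real_derivative G' x) (at x)) \<and> continuous_on UNIV G' \<and>
        (\<forall>x. 0 < G' x) \<and> bounded (range G')) \<and>
     integrable (law D) (\<lambda>w. outer (Vof D w) (Vof D w)) \<and>
     pos_def (\<integral>w. outer (Vof D w) (Vof D w) \<partial>law D) \<and>
     (\<forall>j. (\<integral>w. rho D j (Vof D w) \<partial>P0j D j) > 0 \<longrightarrow>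
        integrable (P0j D j) (\<lambda>w. outer (rhoV D j w) (rhoV D j w)) \<and>
        pos_def (cov_mat (P0j D j) (rhoV D j)))"


section \<open>Projection, asymptotic variances of the given form, and the class of estimators\<close>

text \<open>If \<open>rho j\<close> vanishes almost surely under \<open>P0j D j\<close>, the covariance matrix below is
  singular and \<open>matrix_inv\<close> is unspecified, but the matrix multiplying it is zero.\<close>

definition Qsc :: "('w, 'x, 'c::finite, 'u::finite, 'j::finite) merged \<Rightarrow> ('x \<Rightarrow> real^'d) \<Rightarrow>
    'j \<Rightarrow> real^('c + 'u) \<Rightarrow> real^'d" where
  "Qsc D f j v =
     (let m = (\<integral>w. rhoV D j w \<partial>P0j D j) in
      indicator (src D j) v *\<^sub>R
        (((\<integral>w. outer (rho D j (Vof D w) *\<^sub>R f (fst w)) (rhoV D j w - m) \<partial>P0j D j)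
            ** matrix_inv (cov_mat (P0j D j) (rhoV D j))) *v (rho D j v *\<^sub>R v - m)))"

definition AV_coef :: "('w, 'x, 'c::finite, 'u::finite, 'j::finite) merged \<Rightarrow> 'j \<Rightarrow> real" where
  "AV_coef D j = nu D j * ((1 - plim D j) / plim D j)"

text \<open>The asymptotic variance formula in which \<open>rho j (V) f(X)\<close> is corrected by \<open>h j (V)\<close>.\<close>

definition AV_form :: "('w, 'x, 'c::finite, 'u::finite, 'j::finite) merged \<Rightarrow> ('x \<Rightarrow> real^'d) \<Rightarrow>
    ('j \<Rightarrow> real^('c + 'u) \<Rightarrow> real^'d) \<Rightarrow> real^'d^'d" where
  "AV_form D f h = cov_mat (P0 D) f + (\<Sum>j\<in>UNIV. AV_coef D j *\<^sub>R
     cov_mat (P0j D j) (\<lambda>w. rho D j (Vof D w) *\<^sub>R f (fst w) - h j (Vof D w)))"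

text \<open>The slopes are homogeneous linear maps; an additive constant would not change the
  covariance matrices.\<close>

definition class_C :: "('w, 'x, 'c::finite, 'u::finite, 'j::finite) merged \<Rightarrow> ('x \<Rightarrow> real^'d) \<Rightarrow>
    (nat \<Rightarrow> 'w \<Rightarrow> real^'d) set" where
  "class_C D f = {T. \<exists>L. (\<forall>j. linear (L j)) \<and>
     has_asymp_var (Om D) (rootn_err T (\<integral>x. f x \<partial>P0 D))
       (AV_form D f (\<lambda>j v. L j (rho D j v *\<^sub>R v)))}"

end

theory Submission
  imports Defs
begin

text \<open>
  Within each source, \<open>Qsc\<close> is the least-squares regression of $\rho^{(j)}(V) f(X)$ on
  $\rho^{(j)}(V) V$ under $P_0^{(j)}$, so its residual is uncorrelated with every linear function
  of $\rho^{(j)}(V) V$. Hence correcting by any other linear function increases the covariance of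
  the residual by a positive semidefinite matrix, and correcting by $0$ increases it by exactly the
  covariance of the projection. The weights of the sources in the asymptotic variance are
  nonnegative because a limit in probability of sampling fractions is at most 1, and \<open>AV\<close> is
  well defined because weak limits are unique. Sources with $\nu^{(j)} = 0$, whose conditional law
  is the junk zero measure, drop out of the sum.
\<close>

section \<open>Outer products, and matrix operations as bounded linear maps\<close>

lemma bounded_bilinear_outer: "bounded_bilinear (outer :: real^'m \<Rightarrow> real^'n \<Rightarrow> real^'n^'m)"
  unfolding bilinear_conv_bounded_bilinear[symmetric] bilinear_def
  by (auto intro!: linearI simp: outer_def vec_eq_iff algebra_simps)

interpretation outer: bounded_bilinear "outer :: real^'m \<Rightarrow> real^'n \<Rightarrow> real^'n^'m"
  by (rule bounded_bilinear_outer)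

lemma transpose_outer: "transpose (outer a b) = outer b a"
  by (simp add: outer_def transpose_def vec_eq_iff)

lemma outer_matrix_left: "outer (A *v a) b = A ** outer a b"
  by (simp add: outer_def matrix_matrix_mult_def matrix_vector_mult_def vec_eq_iff
      sum_distrib_right mult.assoc)

lemma outer_mult_vec: "outer a b *v x = (b \<bullet> x) *\<^sub>R a"
  by (simp add: outer_def matrix_vector_mult_def vec_eq_iff inner_vec_def
      sum_distrib_left mult_ac)

lemma transpose_add: "transpose (A + B) = transpose A + transpose (B :: real^'n^'m)"
  by (simp add: transpose_def vec_eq_iff)

text \<open>This and the next two facts allow transposition, multiplication by a fixed matrix and
  quadratic forms to pass through the Bochner integral.\<close>

lemma bounded_linear_transpose: "bounded_linear (transpose :: real^'n^'m \<Rightarrow> real^'m^'n)"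
  unfolding linear_conv_bounded_linear[symmetric]
  by (rule linearI) (simp_all add: transpose_add transpose_scalar)

lemma bounded_linear_matrix_mult:
  "bounded_linear ((**) (A :: real^'n^'m) :: real^'p^'n \<Rightarrow> real^'p^'m)"
  unfolding linear_conv_bounded_linear[symmetric]
  by (rule linearI)
    (simp_all add: matrix_matrix_mult_def vec_eq_iff algebra_simps sum.distrib sum_distrib_left)

lemma bounded_linear_quadratic_form:
  "bounded_linear (\<lambda>A :: real^'n^'n. x \<bullet> (A *v x))"
  unfolding linear_conv_bounded_linear[symmetric]
  by (rule linearI)
    (simp_all add: matrix_vector_mult_add_rdistrib inner_add_right scaleR_matrix_vector_assoc[symmetric])

section \<open>Uniqueness of weak limits\<close>

text \<open>The indicator of a closed set is a pointwise limit of bounded continuous functions of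
  the distance to the set, whose integrals weak convergence determines.\<close>

lemma weak_limit_measure_closed_eq:
  fixes F :: "(real^'d) set"
  assumes 1: "weak_limit M Z \<mu>" and 2: "weak_limit M Z \<mu>'" and F: "closed F"
  shows "measure \<mu> F = measure \<mu>' F"
proof (cases "F = {}")
  case False
  \<comment> \<open>\<open>g n\<close> is 1 on \<open>F\<close> and vanishes at distance
    \<open>1 / n\<close> or more. The empty set is split off because \<open>infdist\<close> to it is
    0 by convention, which would make \<open>g n\<close> constantly 1.\<close>
  define g where "g n x = max 0 (1 - real n * infdist x F)" for n x
  have g_cont: "continuous_on UNIV (g n)" for n
    unfolding g_def by (intro continuous_intros)
  have g01: "0 \<le> g n x" "g n x \<le> 1" for n x
    by (auto simp: g_def infdist_nonneg)
  have g_bdd: "bounded (range (g n))" for n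
    by (rule boundedI[of _ 1]) (use g01 in auto)
  have g_lim: "(\<lambda>n. g n x) \<longlonglongrightarrow> indicator F x" for x
  proof (cases "x \<in> F")
    case True
    then show ?thesis by (simp add: g_def)
  next
    case nx: False
    then have pos: "infdist x F > 0"
      using infdist_pos_not_in_closed[OF F False] by blast
    obtain k :: nat where k: "1 / infdist x F < real k" using reals_Archimedean2 by blast
    have "g n x = 0" if "n \<ge> k" for n
    proof -
      have "1 / infdist x F \<le> real n" using k that by simp
      then have "1 \<le> real n * infdist x F" using pos by (simp add: field_simps)
      then show ?thesis by (simp add: g_def)
    qed
    then have "\<forall>\<^sub>F n in sequentially. g n x = 0" using eventually_sequentially by blast
    then show ?thesis using nx by (simp add: tendsto_eventually)
  qed
  have conv: "(\<lambda>n. \<integral>x. g n x \<partial>\<kappa>) \<longlonglongrightarrow> measure \<kappa> F"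
    if "weak_limit M Z \<kappa>" for \<kappa>
  proof -
    interpret prob_space \<kappa> using that by (simp add: weak_limit_def)
    have sets: "sets \<kappa> = sets borel" using that by (simp add: weak_limit_def)
    have "(\<lambda>n. \<integral>x. g n x \<partial>\<kappa>) \<longlonglongrightarrow> (\<integral>x. indicator F x \<partial>\<kappa>)"
    proof (rule integral_dominated_convergence[where w = "\<lambda>_. 1"])
      show "indicator F \<in> borel_measurable \<kappa>"
        using F sets by (intro borel_measurable_indicator) auto
      show "g n \<in> borel_measurable \<kappa>" for n
        by (subst measurable_cong_sets[OF sets refl])
          (rule borel_measurable_continuous_onI[OF g_cont])
    qed (use g_lim g01 in auto)
    moreover have "(\<integral>x. indicator F x \<partial>\<kappa>) = measure \<kappa> F"
      using sets_eq_imp_space_eq[OF sets] by simp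
    ultimately show ?thesis by simp
  qed
  \<comment> \<open>Both integrals are limits of the same real sequence.\<close>
  have "(\<integral>x. g n x \<partial>\<mu>) = (\<integral>x. g n x \<partial>\<mu>')" for n
    using 1 2 g_cont[of n] g_bdd[of n] unfolding weak_limit_def
    by (intro LIMSEQ_unique[of "\<lambda>N. \<integral>\<omega>. g n (Z N \<omega>) \<partial>M"]) auto
  then show ?thesis using conv[OF 1] conv[OF 2] by (auto intro: LIMSEQ_unique)
qed simp

text \<open>The closed sets form an intersection-stable generator of the Borel sets and contain the
  whole space, which has finite mass.\<close>

lemma weak_limit_unique:
  assumes "weak_limit M Z \<mu>" "weak_limit M Z \<mu>'"
  shows "\<mu> = \<mu>'"
proof (rule measure_eqI_generator_eq[where E = "Collect closed" and \<Omega> = UNIV and A = "\<lambda>_. UNIV"])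
  interpret \<mu>: prob_space \<mu> using assms(1) by (simp add: weak_limit_def)
  interpret \<mu>': prob_space \<mu>' using assms(2) by (simp add: weak_limit_def)
  show "Int_stable (Collect closed)" by (auto simp: Int_stable_def)
  show "emeasure \<mu> X = emeasure \<mu>' X" if "X \<in> Collect closed" for X
    using weak_limit_measure_closed_eq[OF assms] that
    by (simp add: \<mu>.emeasure_eq_measure \<mu>'.emeasure_eq_measure)
  show "emeasure \<mu> UNIV \<noteq> \<infinity>" by (simp add: \<mu>.emeasure_eq_measure)
  show "sets \<mu> = sigma_sets UNIV (Collect closed)" "sets \<mu>' = sigma_sets UNIV (Collect closed)"
    using assms by (simp_all add: weak_limit_def borel_eq_closed)
qed simp_all

text \<open>The limit law is unique, hence so is its covariance matrix, and the definite description
  in \<open>AV\<close> denotes it.\<close>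

lemma AV_eq:
  assumes "has_asymp_var M Z \<Sigma>"
  shows "AV M Z = \<Sigma>"
  unfolding AV_def
  using assms by (rule the_equality) (use assms weak_limit_unique in \<open>auto simp: has_asymp_var_def\<close>)

section \<open>Cross-covariances of square-integrable random vectors\<close>

text \<open>A scalar condition on the norm is convenient for domination arguments;
  \<open>sq_integrable_outerI\<close> derives it from integrability of the second moment
  matrix.\<close>

definition sq_integrable :: "'a measure \<Rightarrow> ('a \<Rightarrow> real^'n) \<Rightarrow> bool" where
  "sq_integrable Q g \<longleftrightarrow> g \<in> borel_measurable Q \<and> integrable Q (\<lambda>x. (norm (g x))\<^sup>2)"

definition cross_cov :: "'a measure \<Rightarrow> ('a \<Rightarrow> real^'m) \<Rightarrow> ('a \<Rightarrow> real^'n) \<Rightarrow> real^'n^'m" where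
  "cross_cov Q g h = (\<integral>x. outer (g x - (\<integral>y. g y \<partial>Q)) (h x - (\<integral>y. h y \<partial>Q)) \<partial>Q)"

lemma cov_mat_eq_cross_cov: "cov_mat Q h = cross_cov Q h h"
  by (simp add: cov_mat_def cross_cov_def)

lemma norm_add_squared_le: "(norm (a + b))\<^sup>2 \<le> 2 * (norm a)\<^sup>2 + 2 * (norm b)\<^sup>2"
proof -
  have "(norm (a + b))\<^sup>2 \<le> (norm a + norm b)\<^sup>2"
    by (intro power_mono norm_triangle_ineq) simp
  also have "\<dots> \<le> 2 * (norm a)\<^sup>2 + 2 * (norm b)\<^sup>2"
    using sum_squares_bound[of "norm a" "norm b"] by (simp add: power2_sum)
  finally show ?thesis .
qed

lemma sq_integrable_add:
  assumes "sq_integrable Q g" "sq_integrable Q h"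
  shows "sq_integrable Q (\<lambda>x. g x + h x)"
  unfolding sq_integrable_def
proof
  have [measurable]: "g \<in> borel_measurable Q" "h \<in> borel_measurable Q"
    using assms by (simp_all add: sq_integrable_def)
  show "(\<lambda>x. g x + h x) \<in> borel_measurable Q" by measurable
  have "integrable Q (\<lambda>x. 2 * (norm (g x))\<^sup>2 + 2 * (norm (h x))\<^sup>2)"
    using assms by (simp add: sq_integrable_def)
  then show "integrable Q (\<lambda>x. (norm (g x + h x))\<^sup>2)"
    by (rule Bochner_Integration.integrable_bound) (use norm_add_squared_le in auto)
qed

lemma sq_integrable_bounded_linear:
  assumes "sq_integrable Q g" "bounded_linear A"
  shows "sq_integrable Q (\<lambda>x. A (g x))"
  unfolding sq_integrable_def
proof
  interpret A: bounded_linear A by fact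
  have [measurable]: "g \<in> borel_measurable Q" "A \<in> borel_measurable borel"
    using assms A.continuous_on[OF continuous_on_id] 
    by (auto simp: sq_integrable_def intro!: borel_measurable_continuous_onI)
  show "(\<lambda>x. A (g x)) \<in> borel_measurable Q" by measurable
  obtain K where K: "\<And>x. norm (A x) \<le> norm x * K" using A.bounded by blast
  have "integrable Q (\<lambda>x. (norm (g x))\<^sup>2 * K\<^sup>2)"
    using assms by (simp add: sq_integrable_def)
  then show "integrable Q (\<lambda>x. (norm (A (g x)))\<^sup>2)"
    by (rule Bochner_Integration.integrable_bound)
      (use K in \<open>auto simp: power_mult_distrib[symmetric] intro!: power_mono\<close>)
qed

lemma sq_integrable_matrix:
  "sq_integrable Q g \<Longrightarrow> sq_integrable Q (\<lambda>x. A *v g x)"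
  by (rule sq_integrable_bounded_linear[OF _ matrix_vector_mul_bounded_linear])

lemma sq_integrable_diff:
  assumes "sq_integrable Q g" "sq_integrable Q h"
  shows "sq_integrable Q (\<lambda>x. g x - h x)"
  using sq_integrable_add[OF assms(1) sq_integrable_bounded_linear[OF assms(2), of uminus]]
  by (simp add: bounded_linear_minus bounded_linear_ident)

text \<open>The outer product is bounded by a multiple of the product of the norms, and that product
  by the sum of their squares.\<close>

lemma integrable_outer:
  assumes "sq_integrable Q g" "sq_integrable Q h"
  shows "integrable Q (\<lambda>x. outer (g x) (h x))"
proof -
  have [measurable]: "g \<in> borel_measurable Q" "h \<in> borel_measurable Q"
    using assms by (simp_all add: sq_integrable_def)
  obtain K where K: "K \<ge> 0" "\<And>a b. norm (outer a b :: real^'c^'b) \<le> norm a * norm b * K"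
    using outer.nonneg_bounded by blast
  have "integrable Q (\<lambda>x. ((norm (g x))\<^sup>2 + (norm (h x))\<^sup>2) * K)"
    using assms by (simp add: sq_integrable_def)
  then show ?thesis
  proof (rule Bochner_Integration.integrable_bound)
    show "AE x in Q. norm (outer (g x) (h x)) \<le> norm (((norm (g x))\<^sup>2 + (norm (h x))\<^sup>2) * K)"
    proof (rule AE_I2)
      fix x
      have "norm (g x) * norm (h x) \<le> (norm (g x))\<^sup>2 + (norm (h x))\<^sup>2"
        using sum_squares_bound[of "norm (g x)" "norm (h x)"]
          mult_nonneg_nonneg[OF norm_ge_zero[of "g x"] norm_ge_zero[of "h x"]] by linarith
      then have "norm (g x) * norm (h x) * K \<le> ((norm (g x))\<^sup>2 + (norm (h x))\<^sup>2) * K"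
        using K(1) by (rule mult_right_mono)
      then show "norm (outer (g x) (h x)) \<le> norm (((norm (g x))\<^sup>2 + (norm (h x))\<^sup>2) * K)"
        using K(2)[of "g x" "h x"] by simp
    qed
    show "(\<lambda>x. outer (g x) (h x)) \<in> borel_measurable Q"
      by (rule borel_measurable_continuous_Pair[where H = outer])
        (auto intro!: outer.continuous_on continuous_intros simp: split_beta)
  qed
qed

context prob_space
begin

lemma sq_integrable_const: "sq_integrable M (\<lambda>_. c)"
  by (simp add: sq_integrable_def)

text \<open>Constants are integrable on a probability space, and
  \<open>t \<le> 1 + t^2\<close>.\<close>

lemma sq_integrable_imp_integrable:
  assumes "sq_integrable M g"
  shows "integrable M g"
proof -
  have [measurable]: "g \<in> borel_measurable M" using assms by (simp add: sq_integrable_def)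
  have "integrable M (\<lambda>x. 1 + (norm (g x))\<^sup>2)" using assms by (simp add: sq_integrable_def)
  then show ?thesis
  proof (rule Bochner_Integration.integrable_bound)
    have "norm (g x) \<le> 1 + (norm (g x))\<^sup>2" for x
      using sum_squares_bound[of "norm (g x)" 1] norm_ge_zero[of "g x"]
      unfolding mult_1_right power_one by linarith
    then show "AE x in M. norm (g x) \<le> norm (1 + (norm (g x))\<^sup>2)"
      by (simp add: abs_of_nonneg)
  qed measurable
qed

lemma integrable_cross_cov:
  assumes "sq_integrable M g" "sq_integrable M h"
  shows "integrable M (\<lambda>x. outer (g x - c) (h x - d))"
  using assms by (intro integrable_outer sq_integrable_diff sq_integrable_const)

text \<open>Centering one factor suffices, since a constant paired with a centered vector integrates
  to 0. The right-hand side has the shape of the moment matrix in \<open>Qsc\<close>.\<close>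

lemma cross_cov_eq:
  assumes "sq_integrable M g" "sq_integrable M h"
  shows "cross_cov M g h = (\<integral>x. outer (g x) (h x - (\<integral>y. h y \<partial>M)) \<partial>M)"
proof -
  let ?h = "\<lambda>x. h x - (\<integral>y. h y \<partial>M)"
  have sq: "sq_integrable M ?h" by (intro sq_integrable_diff sq_integrable_const assms)
  have "(\<integral>x. ?h x \<partial>M) = 0"
    using sq_integrable_imp_integrable[OF assms(2)] by (simp add: prob_space)
  then have "(\<integral>x. outer (\<integral>y. g y \<partial>M) (?h x) \<partial>M) = 0"
    using integral_bounded_linear[OF outer.bounded_linear_right sq_integrable_imp_integrable[OF sq]]
    by (simp add: outer.zero_right)
  then show ?thesis
    unfolding cross_cov_def outer.diff_left
    using integrable_outer[OF assms(1) sq]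
      integrable_outer[OF sq_integrable_const[of "\<integral>y. g y \<partial>M"] sq] by simp
qed

text \<open>Swapping the arguments makes linearity rules for the left argument sufficient.\<close>

lemma transpose_cross_cov:
  assumes "sq_integrable M g" "sq_integrable M h"
  shows "transpose (cross_cov M g h) = cross_cov M h g"
  unfolding cross_cov_def
  using integral_bounded_linear[OF bounded_linear_transpose integrable_cross_cov[OF assms]]
  by (simp add: transpose_outer)

lemma cross_cov_add_left:
  assumes "sq_integrable M g" "sq_integrable M g'" "sq_integrable M h"
  shows "cross_cov M (\<lambda>x. g x + g' x) h = cross_cov M g h + cross_cov M g' h"
proof -
  have "cross_cov M (\<lambda>x. g x + g' x) h = (\<integral>x. outer (g x) (h x - (\<integral>y. h y \<partial>M))
      + outer (g' x) (h x - (\<integral>y. h y \<partial>M)) \<partial>M)"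
    by (subst cross_cov_eq) (auto intro!: sq_integrable_add assms simp: outer.add_left)
  also have "\<dots> = cross_cov M g h + cross_cov M g' h"
    by (subst Bochner_Integration.integral_add)
      (auto intro!: integrable_outer sq_integrable_diff sq_integrable_const
        simp: cross_cov_eq assms)
  finally show ?thesis .
qed

lemma cross_cov_matrix_left:
  assumes "sq_integrable M g" "sq_integrable M h"
  shows "cross_cov M (\<lambda>x. A *v g x) h = A ** cross_cov M g h"
proof -
  let ?h = "\<lambda>x. h x - (\<integral>y. h y \<partial>M)"
  have "(\<integral>x. A ** outer (g x) (?h x) \<partial>M) = A ** (\<integral>x. outer (g x) (?h x) \<partial>M)"
    by (intro integral_bounded_linear[OF bounded_linear_matrix_mult] integrable_outer
        sq_integrable_diff sq_integrable_const assms)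
  then show ?thesis
    by (simp add: cross_cov_eq sq_integrable_matrix assms outer_matrix_left)
qed

text \<open>Pythagoras: both cross terms vanish, the second being the transpose of the
  first.\<close>

lemma cov_mat_add:
  assumes r: "sq_integrable M r" and s: "sq_integrable M s" and orth: "cross_cov M r s = 0"
  shows "cov_mat M (\<lambda>x. r x + s x) = cov_mat M r + cov_mat M s"
proof -
  have rs: "sq_integrable M (\<lambda>x. r x + s x)" by (intro sq_integrable_add r s)
  have orth': "cross_cov M s r = 0"
    using transpose_cross_cov[OF r s] orth by (simp add: transpose_def vec_eq_iff)
  have "cross_cov M r (\<lambda>x. r x + s x) = cross_cov M r r"
    using transpose_cross_cov[OF rs r] transpose_cross_cov[OF r r]
    by (simp add: cross_cov_add_left r s orth')
  moreover have "cross_cov M s (\<lambda>x. r x + s x) = cross_cov M s s"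
    using transpose_cross_cov[OF rs s] transpose_cross_cov[OF s s]
    by (simp add: cross_cov_add_left r s orth)
  ultimately show ?thesis
    by (simp add: cov_mat_eq_cross_cov cross_cov_add_left r s rs)
qed

text \<open>The hypothesis on \<open>A\<close> is the normal equation of the linear regression of \<open>g\<close> on \<open>h\<close>.\<close>

lemma cov_mat_regression:
  assumes g: "sq_integrable M g" and h: "sq_integrable M h"
    and A: "A ** cov_mat M h = cross_cov M g h"
  shows "cov_mat M (\<lambda>x. g x - B *v h x)
    = cov_mat M (\<lambda>x. g x - A *v h x) + cov_mat M (\<lambda>x. (A - B) *v h x)"
proof -
  let ?r = "\<lambda>x. g x - A *v h x" and ?s = "\<lambda>x. (A - B) *v h x"
  have r: "sq_integrable M ?r" and s: "sq_integrable M ?s"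
    by (intro sq_integrable_diff sq_integrable_matrix g h)+
  \<comment> \<open>Splitting \<open>g\<close> into residual and fitted value, the normal equation
    leaves a residual uncorrelated with \<open>h\<close>.\<close>
  have "cross_cov M g h = cross_cov M (\<lambda>x. ?r x + A *v h x) h" by simp
  also have "\<dots> = cross_cov M ?r h + A ** cov_mat M h"
    unfolding cov_mat_eq_cross_cov
    by (subst cross_cov_add_left[OF r sq_integrable_matrix[OF h] h])
      (simp add: cross_cov_matrix_left h)
  finally have "cross_cov M ?r h = 0" using A by simp
  \<comment> \<open>Orthogonality to \<open>h\<close> extends to every matrix image of
    \<open>h\<close>: transpose, multiply on the left, transpose back.\<close>
  then have "cross_cov M h ?r = 0"
    using transpose_cross_cov[OF r h] by (simp add: transpose_def vec_eq_iff)
  then have "cross_cov M ?s ?r = 0"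
    by (simp add: cross_cov_matrix_left[OF h r] matrix_matrix_mult_def vec_eq_iff)
  then have "cross_cov M ?r ?s = 0"
    using transpose_cross_cov[OF s r] by (simp add: transpose_def vec_eq_iff)
  from cov_mat_add[OF r s this] show ?thesis
    by (simp add: matrix_vector_mult_diff_rdistrib)
qed

text \<open>The quadratic form at \<open>x\<close> is the integral of the square of the inner
  product of \<open>x\<close> with the centered vector.\<close>

lemma pos_semidef_cov_mat:
  assumes "sq_integrable M h"
  shows "pos_semidef (cov_mat M h)"
  unfolding pos_semidef_def
proof (intro conjI allI)
  show "transpose (cov_mat M h) = cov_mat M h"
    by (simp add: cov_mat_eq_cross_cov transpose_cross_cov assms)
  fix x
  let ?m = "\<integral>y. h y \<partial>M"
  have "x \<bullet> (cov_mat M h *v x) = (\<integral>w. x \<bullet> (outer (h w - ?m) (h w - ?m) *v x) \<partial>M)"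
    unfolding cov_mat_def
    by (rule integral_bounded_linear[OF bounded_linear_quadratic_form
        integrable_cross_cov[OF assms assms], symmetric])
  also have "\<dots> \<ge> 0"
    by (intro integral_nonneg_AE AE_I2) (simp add: outer_mult_vec inner_commute)
  finally show "0 \<le> x \<bullet> (cov_mat M h *v x)" .
qed

lemma cov_mat_add_const:
  assumes "sq_integrable M h"
  shows "cov_mat M (\<lambda>x. h x + c) = cov_mat M h"
  using sq_integrable_imp_integrable[OF assms]
  by (simp add: cov_mat_def prob_space)

end

text \<open>Serves to replace \<open>Qsc\<close>, which carries an indicator of the source, by an
  affine map that agrees with it only almost surely.\<close>

lemma cov_mat_cong_AE:
  fixes g h :: "'a \<Rightarrow> real^'n"
  assumes "AE x in Q. g x = h x" "g \<in> borel_measurable Q" "h \<in> borel_measurable Q"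
  shows "cov_mat Q g = cov_mat Q h"
proof -
  note [measurable] = assms(2,3)
  have meas: "(\<lambda>x. outer (k x - c) (k x - c)) \<in> borel_measurable Q"
    if [measurable]: "k \<in> borel_measurable Q" for k :: "'a \<Rightarrow> real^'n" and c
    by (rule borel_measurable_continuous_Pair[where H = outer])
      (auto intro!: outer.continuous_on continuous_intros simp: split_beta)
  have eq: "(\<integral>x. g x \<partial>Q) = (\<integral>x. h x \<partial>Q)" by (rule integral_cong_AE) (use assms in auto)
  show ?thesis unfolding cov_mat_def eq
    by (rule integral_cong_AE) (use assms meas in auto)
qed

section \<open>Positive semidefinite and positive definite matrices, and integrability under
  conditioning\<close>

lemma pos_semidef_0: "pos_semidef 0"
  by (simp add: pos_semidef_def transpose_def vec_eq_iff)

lemma pos_semidef_add: "pos_semidef A \<Longrightarrow> pos_semidef B \<Longrightarrow> pos_semidef (A + B)"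
  by (simp add: pos_semidef_def transpose_add matrix_vector_mult_add_rdistrib inner_add_right)

lemma pos_semidef_scaleR: "0 \<le> c \<Longrightarrow> pos_semidef A \<Longrightarrow> pos_semidef (c *\<^sub>R A)"
  by (simp add: pos_semidef_def transpose_scalar scaleR_matrix_vector_assoc[symmetric])

lemma pos_semidef_sum: "(\<And>i. i \<in> I \<Longrightarrow> pos_semidef (A i)) \<Longrightarrow> pos_semidef (sum A I)"
  by (induction I rule: infinite_finite_induct) (simp_all add: pos_semidef_0 pos_semidef_add)

text \<open>A vector in the kernel makes the quadratic form 0, so positive definiteness forces a
  trivial kernel.\<close>

lemma pos_def_invertible:
  assumes "pos_def A"
  shows "invertible A"
  using assms matrix_left_invertible_ker[of A]
  by (auto simp: invertible_left_inverse pos_def_def)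

lemma matrix_inv_left:
  assumes "invertible A"
  shows "matrix_inv A ** A = mat 1"
  using someI_ex[OF assms[unfolded invertible_def]] by (simp add: matrix_inv_def)

text \<open>The conditional integral of the norm is at most the unconditional one divided by the
  positive mass of the event.\<close>

lemma integrable_uniform_measure:
  fixes g :: "'a \<Rightarrow> 'b::{banach,second_countable_topology}"
  assumes "integrable M g" "A \<in> sets M" "emeasure M A \<noteq> 0" "emeasure M A \<noteq> \<infinity>"
  shows "integrable (uniform_measure M A) g"
proof -
  have [measurable]: "g \<in> borel_measurable M" "A \<in> sets M" using assms by auto
  have "(\<integral>\<^sup>+x. ennreal (norm (g x)) \<partial>uniform_measure M A)
      = (\<integral>\<^sup>+x. ennreal (norm (g x)) * indicator A x \<partial>M) / emeasure M A"
    by (rule nn_integral_uniform_measure) auto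
  moreover have "(\<integral>\<^sup>+x. ennreal (norm (g x)) * indicator A x \<partial>M) \<le> (\<integral>\<^sup>+x. norm (g x) \<partial>M)"
    by (intro nn_integral_mono) (auto split: split_indicator)
  moreover have "(\<integral>\<^sup>+x. norm (g x) \<partial>M) < \<infinity>"
    using assms(1) by (simp add: integrable_iff_bounded)
  ultimately have "(\<integral>\<^sup>+x. ennreal (norm (g x)) \<partial>uniform_measure M A) < \<infinity>"
    using assms(3,4) by (auto simp: ennreal_divide_eq_top_iff top_unique
        simp flip: less_top)
  then show ?thesis by (simp add: integrable_iff_bounded)
qed

text \<open>The squared norm is the trace of the outer product, and the trace is bounded
  linear.\<close>

lemma sq_integrable_outerI:
  assumes "g \<in> borel_measurable Q" "integrable Q (\<lambda>x. outer (g x) (g x))"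
  shows "sq_integrable Q g"
proof -
  have "bounded_linear (\<lambda>A :: real^'n^'n. \<Sum>i\<in>UNIV. A $ i $ i)"
    unfolding linear_conv_bounded_linear[symmetric]
    by (rule linearI) (simp_all add: sum.distrib sum_distrib_left)
  from integrable_bounded_linear[OF this assms(2)]
  have "integrable Q (\<lambda>x. (norm (g x))\<^sup>2)"
    by (simp add: outer_def power2_norm_eq_inner inner_vec_def)
  then show ?thesis using assms(1) by (simp add: sq_integrable_def)
qed

section \<open>Consequences of the sampling model\<close>

lemma join_vec_measurable [measurable (raw)]:
  assumes "g \<in> borel_measurable Q" "h \<in> borel_measurable Q"
  shows "(\<lambda>x. join_vec (g x) (h x)) \<in> borel_measurable Q"
proof (rule borel_measurable_continuous_Pair[OF assms])
  have "continuous_on UNIV (\<lambda>x. case k of Inl i \<Rightarrow> fst x $ i | Inr i \<Rightarrow> snd x $ i)" for k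
    by (cases k) (auto intro!: continuous_intros)
  then show "continuous_on UNIV (\<lambda>x. join_vec (fst x) (snd x))"
    unfolding join_vec_def by (intro continuous_on_vec_lambda)
qed

lemma sampling_modelD:
  assumes "sampling_model D"
  shows "prob_space (Om D)" "prob_space (law D)"
    and "sets (law D) = sets (Xsp D \<Otimes>\<^sub>M borel)"
    and "coarsen D \<in> borel_measurable (Xsp D)"
    and "\<forall>j. src D j \<in> sets borel"
    and "prob_space.indep_vars (Om D) (\<lambda>_. law D) (Wu D) UNIV"
    and "\<forall>N j. nsel D N j \<in> measurable (data_alg D N) (count_space UNIV)"
    and "\<forall>N j. AE \<omega> in Om D. nsel D N j \<omega> \<le> Nsrc D N j \<omega>"
    and "\<exists>c>0. \<forall>j. c \<le> plim D j"
    and "\<forall>j. \<forall>\<epsilon>>0. (\<lambda>N. measure (Om D) {\<omega> \<in> space (Om D).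
        \<bar>real (nsel D N j \<omega>) / real (Nsrc D N j \<omega>) - plim D j\<bar> > \<epsilon>}) \<longlonglongrightarrow> 0"
  using assms unfolding sampling_model_def by - (elim conjE, assumption)+

lemma Vof_measurable:
  assumes "sampling_model D"
  shows "Vof D \<in> borel_measurable (law D)"
proof -
  have [measurable]: "coarsen D \<in> borel_measurable (Xsp D)"
    using sampling_modelD[OF assms] by simp
  have sets: "sets (law D) = sets (Xsp D \<Otimes>\<^sub>M borel)" using sampling_modelD[OF assms] by simp
  have "(\<lambda>w. join_vec (coarsen D (fst w)) (snd w)) \<in> borel_measurable (Xsp D \<Otimes>\<^sub>M borel)"
    by measurable
  then show ?thesis
    unfolding Vof_def measurable_cong_sets[OF sets refl] by simp
qed

text \<open>A weight function factors through the finite set of sources containing its argument.\<close>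

lemma rho_measurable:
  fixes D :: "('w, 'x, 'c::finite, 'u::finite, 'j::finite) merged"
  assumes D: "sampling_model D" and w: "weight_function D"
  shows "rho D j \<in> borel_measurable borel"
proof -
  define r where "r v = {j. v \<in> src D j}" for v
  have src: "src D j \<in> sets borel" for j using sampling_modelD[OF D] by simp
  have zero: "rho D j v = 0" if "v \<notin> src D j" for v
    using w[unfolded weight_function_def, THEN conjunct2, THEN conjunct2, THEN conjunct1] that
    by (elim allE[of _ j] allE[of _ v] mp)
  have const: "rho D j v = rho D j v'"
    if "v \<in> (\<Union>j. src D j)" "v' \<in> (\<Union>j. src D j)" "r v' = r v" for v v'
    using w[unfolded weight_function_def, THEN conjunct2, THEN conjunct1, THEN bspec, OF that(1),
        THEN bspec, OF that(2), THEN mp, OF that(3)[unfolded r_def, symmetric]] by (rule spec)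
  have r_meas: "r \<in> measurable borel (count_space UNIV)"
  proof (subst measurable_count_space_eq2, simp, intro conjI ballI)
    fix S
    \<comment> \<open>\<open>r\<close> takes finitely many values, so singletons suffice; the
      preimage of one is a finite intersection of sources and complements of sources.\<close>
    have "r -` {S} \<inter> space borel = (\<Inter>j. {v. v \<in> src D j \<longleftrightarrow> j \<in> S})"
      by (simp add: r_def set_eq_iff)
    also have "\<dots> \<in> sets borel"
    proof (intro sets.finite_INT)
      show "{v. v \<in> src D j \<longleftrightarrow> j \<in> S} \<in> sets borel" for j
        by (cases "j \<in> S") (simp_all add: src borel_comp flip: Compl_eq)
    qed simp_all
    finally show "r -` {S} \<inter> space borel \<in> sets borel" .
  qed simp
  \<comment> \<open>\<open>F\<close> evaluates the weight at a chosen representative of each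
    membership pattern. The empty pattern is separate because constancy is assumed only on the union
    of the sources; outside it the weight is 0.\<close>
  define F where "F S = (if S = {} then 0 else rho D j (SOME v. r v = S))" for S
  have "rho D j v = F (r v)" for v
  proof (cases "r v = {}")
    case True
    then have "v \<notin> src D j" by (auto simp: r_def)
    then show ?thesis using True by (simp add: F_def zero)
  next
    case False
    define v' where "v' = (SOME v'. r v' = r v)"
    have v': "r v' = r v" unfolding v'_def by (rule someI) (rule refl)
    with False have "v \<in> (\<Union>j. src D j)" "v' \<in> (\<Union>j. src D j)" by (auto simp: r_def)
    then have "rho D j v = rho D j v'"
      using const v' by blast
    then show ?thesis using False by (simp add: F_def v'_def)
  qed
  then have "rho D j = F \<circ> r" by auto
  then show ?thesis using measurable_comp[OF r_meas, of F borel] by simp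
qed

text \<open>Sampling fractions are almost surely at most 1, so they cannot approach a larger limit
  in probability.\<close>

lemma plim_le_1:
  fixes D :: "('w, 'x, 'c::finite, 'u::finite, 'j::finite) merged"
  assumes D: "sampling_model D"
  shows "plim D j \<le> 1"
proof (rule ccontr)
  assume "\<not> plim D j \<le> 1"
  \<comment> \<open>Half the excess over 1: every fraction at most 1 is then at distance at least
    twice \<open>\<epsilon>\<close> from the limit, giving the strict inequality.\<close>
  define \<epsilon> where "\<epsilon> = (plim D j - 1) / 2"
  have \<epsilon>: "\<epsilon> > 0" using \<open>\<not> plim D j \<le> 1\<close> by (simp add: \<epsilon>_def)
  interpret Om: prob_space "Om D" using sampling_modelD[OF D] by simp
  let ?S = "\<lambda>N. {\<omega> \<in> space (Om D).
        \<bar>real (nsel D N j \<omega>) / real (Nsrc D N j \<omega>) - plim D j\<bar> > \<epsilon>}"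
  have Wu: "Wu D i \<in> measurable (Om D) (law D)" for i
    using sampling_modelD(6)[OF D] by (simp add: Om.indep_vars_def)
  have "measure (Om D) (?S N) = 1" for N
  proof -
    \<comment> \<open>\<open>nsel\<close> is assumed measurable only for the data sigma-algebra,
      which is therefore shown to lie inside that of \<open>Om D\<close>.\<close>
    have "(\<lambda>\<omega>. \<lambda>i\<in>{..<N}. Wu D i \<omega>) \<in> measurable (Om D) (PiM {..<N} (\<lambda>_. law D))"
      using Wu by (intro measurable_restrict)
    then have "sets (data_alg D N) \<subseteq> sets (Om D)"
      unfolding data_alg_def by (intro sets_image_in_sets) auto
    then have "measurable (data_alg D N) (count_space UNIV) \<subseteq> measurable (Om D) (count_space UNIV)"
      by (intro measurable_mono) (auto simp: data_alg_def)
    then have [measurable]: "nsel D N j \<in> measurable (Om D) (count_space UNIV)"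
      using sampling_modelD(7)[OF D] by blast
    have [measurable]: "Nsrc D N j \<in> measurable (Om D) (count_space UNIV)"
      unfolding Nsrc_def
    proof (rule measurable_card)
      fix i
      have [measurable]: "(\<lambda>\<omega>. Vof D (Wu D i \<omega>)) \<in> borel_measurable (Om D)"
        by (rule measurable_compose[OF Wu Vof_measurable[OF D]])
      have [measurable]: "src D j \<in> sets borel" using sampling_modelD[OF D] by simp
      have "{\<omega> \<in> space (Om D). i < N \<and> Vof D (Wu D i \<omega>) \<in> src D j} \<in> sets (Om D)"
        by measurable
      then show "{\<omega> \<in> space (Om D). i \<in> units D N j \<omega>} \<in> sets (Om D)"
        by (simp add: units_def)
    qed
    have "AE \<omega> in Om D. nsel D N j \<omega> \<le> Nsrc D N j \<omega>"
      using sampling_modelD[OF D] by simp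
    then have "AE \<omega> in Om D. \<omega> \<in> ?S N"
    proof (rule AE_mp, intro AE_I2 impI)
      fix \<omega> assume \<omega>: "\<omega> \<in> space (Om D)" and le: "nsel D N j \<omega> \<le> Nsrc D N j \<omega>"
      \<comment> \<open>An empty source is covered, since division by 0 gives 0.\<close>
      have "real (nsel D N j \<omega>) / real (Nsrc D N j \<omega>) \<le> 1"
        using le by (intro divide_le_eq_1[THEN iffD2]) linarith
      then show "\<omega> \<in> ?S N" using \<omega> \<epsilon> by (simp add: \<epsilon>_def)
    qed
    then show ?thesis by (subst Om.prob_eq_1) auto
  qed
  moreover have "(\<lambda>N. measure (Om D) (?S N)) \<longlonglongrightarrow> 0"
    using sampling_modelD(10)[OF D] \<epsilon> by blast
  ultimately show False by (simp add: LIMSEQ_const_iff)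
qed

text \<open>The bounds \<open>0 < plim D j\<close> and \<open>plim D j \<le> 1\<close> give the
  sign, which is needed for the Loewner comparison to survive weighting by source.\<close>

lemma AV_coef_nonneg:
  assumes "sampling_model D"
  shows "0 \<le> AV_coef D j"
proof -
  have "0 < plim D j" using sampling_modelD(9)[OF assms] by (auto intro: less_le_trans)
  then show ?thesis using plim_le_1[OF assms, of j] by (simp add: AV_coef_def nu_def)
qed

lemma AV_coef_eq_0: "nu D j = 0 \<Longrightarrow> AV_coef D j = 0"
  by (simp add: AV_coef_def)

section \<open>The projection of a single source\<close>

text \<open>The matrix of slopes in the population regression of the weighted \<open>f\<close> on
  \<open>rhoV\<close>, separated from the centering and the indicator in \<open>Qsc\<close>.\<close>

definition Qsc_coef :: "('w, 'x, 'c::finite, 'u::finite, 'j::finite) merged \<Rightarrow>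
    ('x \<Rightarrow> real^'d) \<Rightarrow> 'j \<Rightarrow> real^('c + 'u)^'d" where
  "Qsc_coef D f j =
     (\<integral>w. outer (rho D j (Vof D w) *\<^sub>R f (fst w)) (rhoV D j w - (\<integral>w. rhoV D j w \<partial>P0j D j)) \<partial>P0j D j)
       ** matrix_inv (cov_mat (P0j D j) (rhoV D j))"

lemma calibration_assumptionsD:
  assumes "calibration_assumptions D G \<alpha> \<beta>"
  shows "\<exists>B. AE w in law D. norm (Vof D w) \<le> B"
    and "\<forall>j. (\<integral>w. rho D j (Vof D w) \<partial>P0j D j) > 0 \<longrightarrow>
      integrable (P0j D j) (\<lambda>w. outer (rhoV D j w) (rhoV D j w)) \<and>
      pos_def (cov_mat (P0j D j) (rhoV D j))"
  using assms unfolding calibration_assumptions_def by - (elim conjE, assumption)+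

context
  fixes D :: "('w, 'x, 'c::finite, 'u::finite, 'j::finite) merged"
    and G :: "real \<Rightarrow> real"
    and \<alpha> :: "nat \<Rightarrow> 'j \<Rightarrow> 'w \<Rightarrow> real^('c + 'u)"
    and \<beta> :: "nat \<Rightarrow> 'w \<Rightarrow> real^('c + 'u)"
    and f :: "'x \<Rightarrow> real^'d"
    and j :: 'j
  assumes D: "sampling_model D"
    and w: "weight_function D"
    and cal: "calibration_assumptions D G \<alpha> \<beta>"
    and f: "f \<in> borel_measurable (Xsp D)"
    and f2: "integrable (P0 D) (\<lambda>x. outer (f x) (f x))"
    and nu: "nu D j \<noteq> 0"
begin

lemma in_src_sets: "in_src D j \<in> sets (law D)"
proof -
  have [measurable]: "src D j \<in> sets borel" using sampling_modelD[OF D] by simp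
  note Vof_measurable[OF D, measurable]
  show ?thesis unfolding in_src_def by measurable
qed

lemma in_src_emeasure: "emeasure (law D) (in_src D j) \<noteq> 0" "emeasure (law D) (in_src D j) \<noteq> \<infinity>"
proof -
  interpret prob_space "law D" using sampling_modelD[OF D] by simp
  show "emeasure (law D) (in_src D j) \<noteq> 0" "emeasure (law D) (in_src D j) \<noteq> \<infinity>"
    using nu by (simp_all add: nu_def emeasure_eq_measure)
qed

text \<open>Conditioning yields a probability measure because the source has positive mass, so the
  covariance results for probability spaces apply to \<open>P0j D j\<close>.\<close>

lemma prob_space_P0j: "prob_space (P0j D j)"
  unfolding P0j_def by (rule prob_space_uniform_measure[OF in_src_emeasure])

lemma measurable_P0j: "measurable (P0j D j) M = measurable (law D) M"
  unfolding P0j_def by (rule measurable_cong_sets) simp_all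

lemma AE_P0j_in_src: "AE w in P0j D j. Vof D w \<in> src D j"
  unfolding P0j_def by (rule AE_uniform_measureI[OF in_src_sets]) (auto simp: in_src_def)

lemma rho_Vof_measurable: "(\<lambda>w. rho D j (Vof D w)) \<in> borel_measurable (P0j D j)"
  unfolding measurable_P0j
  by (rule measurable_compose[OF Vof_measurable[OF D] rho_measurable[OF D w]])

lemma rho_bounds: "0 \<le> rho D j v" "rho D j v \<le> 1"
  using w[unfolded weight_function_def, THEN conjunct1] by blast+

lemma rhoV_measurable: "rhoV D j \<in> borel_measurable (P0j D j)"
  unfolding rhoV_def
  using rho_Vof_measurable Vof_measurable[OF D, folded measurable_P0j] by measurable

text \<open>Follows from the bounded support of \<open>V\<close> and weights in the unit interval,
  so it also covers a source whose mean weight is 0.\<close>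

lemma sq_integrable_rhoV: "sq_integrable (P0j D j) (rhoV D j)"
  unfolding sq_integrable_def
proof
  interpret prob_space "P0j D j" by (rule prob_space_P0j)
  note rhoV_measurable[measurable]
  obtain B where "AE w in law D. norm (Vof D w) \<le> B"
    using calibration_assumptionsD(1)[OF cal] by blast
  then have "AE w in P0j D j. norm (Vof D w) \<le> B"
    unfolding P0j_def by (intro AE_uniform_measureI[OF in_src_sets]) auto
  then have "AE w in P0j D j. norm ((norm (rhoV D j w))\<^sup>2) \<le> B\<^sup>2"
  proof (rule AE_mp, intro AE_I2 impI)
    fix w assume "norm (Vof D w) \<le> B"
    then have "norm (rhoV D j w) \<le> B"
      using rho_bounds[of "Vof D w"] mult_left_le_one_le[of "norm (Vof D w)" "rho D j (Vof D w)"]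
      by (simp add: rhoV_def)
    then show "norm ((norm (rhoV D j w))\<^sup>2) \<le> B\<^sup>2" by (simp add: power_mono)
  qed
  then show "integrable (P0j D j) (\<lambda>w. (norm (rhoV D j w))\<^sup>2)"
    by (rule integrable_const_bound) measurable
qed (rule rhoV_measurable)

text \<open>The second moment of \<open>f\<close> is carried from the law of \<open>X\<close> to
  that of \<open>W\<close>, then to the conditional law; weights at most 1 only shrink the
  norm.\<close>

lemma sq_integrable_rho_f: "sq_integrable (P0j D j) (\<lambda>w. rho D j (Vof D w) *\<^sub>R f (fst w))"
  unfolding sq_integrable_def
proof
  have sets: "sets (law D) = sets (Xsp D \<Otimes>\<^sub>M borel)" using sampling_modelD[OF D] by simp
  have fst: "fst \<in> measurable (law D) (Xsp D)"
    unfolding measurable_cong_sets[OF sets refl] by simp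
  have f_meas: "(\<lambda>w. f (fst w)) \<in> borel_measurable (law D)"
    by (rule measurable_compose[OF fst f])
  then show meas: "(\<lambda>w. rho D j (Vof D w) *\<^sub>R f (fst w)) \<in> borel_measurable (P0j D j)"
    using rho_Vof_measurable unfolding measurable_P0j by measurable
  have "integrable (law D) (\<lambda>w. outer (f (fst w)) (f (fst w)))"
    using f2 unfolding P0_def by (rule integrable_distr[OF fst])
  then have "sq_integrable (law D) (\<lambda>w. f (fst w))"
    by (rule sq_integrable_outerI[OF f_meas])
  then have "integrable (P0j D j) (\<lambda>w. (norm (f (fst w)))\<^sup>2)"
    unfolding P0j_def sq_integrable_def
    by (intro integrable_uniform_measure in_src_sets in_src_emeasure) auto
  then show "integrable (P0j D j) (\<lambda>w. (norm (rho D j (Vof D w) *\<^sub>R f (fst w)))\<^sup>2)"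
  proof (rule Bochner_Integration.integrable_bound)
    have "norm (rho D j v *\<^sub>R y) \<le> norm y" for v and y :: "real^'d"
      using rho_bounds[of v] mult_left_le_one_le[of "norm y" "rho D j v"] by simp
    then show "AE w in P0j D j. norm ((norm (rho D j (Vof D w) *\<^sub>R f (fst w)))\<^sup>2)
        \<le> norm ((norm (f (fst w)))\<^sup>2)"
      by (intro AE_I2) (simp add: power_mono del: norm_scaleR)
  qed (use meas in measurable)
qed

text \<open>With positive mean weight the inverse cancels. Otherwise the weight is almost surely 0
  and both sides vanish, whatever value \<open>matrix_inv\<close> takes.\<close>

lemma Qsc_coef_normal_equation:
  "Qsc_coef D f j ** cov_mat (P0j D j) (rhoV D j)
    = cross_cov (P0j D j) (\<lambda>w. rho D j (Vof D w) *\<^sub>R f (fst w)) (rhoV D j)"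
proof -
  interpret prob_space "P0j D j" by (rule prob_space_P0j)
  let ?C = "cross_cov (P0j D j) (\<lambda>w. rho D j (Vof D w) *\<^sub>R f (fst w)) (rhoV D j)"
  have coef: "Qsc_coef D f j = ?C ** matrix_inv (cov_mat (P0j D j) (rhoV D j))"
    by (simp add: Qsc_coef_def cross_cov_eq[OF sq_integrable_rho_f sq_integrable_rhoV])
  show ?thesis
  proof (cases "(\<integral>w. rho D j (Vof D w) \<partial>P0j D j) > 0")
    case True
    then have "pos_def (cov_mat (P0j D j) (rhoV D j))"
      using calibration_assumptionsD(2)[OF cal] by blast
    then show ?thesis
      by (simp add: coef matrix_mul_assoc[symmetric] matrix_inv_left pos_def_invertible)
  next
    case False
    have "integrable (P0j D j) (\<lambda>w. rho D j (Vof D w))"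
      by (rule integrable_const_bound[of _ 1]) (use rho_bounds rho_Vof_measurable in auto)
    moreover have "(\<integral>w. rho D j (Vof D w) \<partial>P0j D j) \<ge> 0"
      using rho_bounds by (intro integral_nonneg_AE) auto
    then have "(\<integral>w. rho D j (Vof D w) \<partial>P0j D j) = 0" using False by linarith
    \<comment> \<open>A nonnegative function with integral 0 vanishes almost everywhere.\<close>
    ultimately have "AE w in P0j D j. rho D j (Vof D w) = 0"
      using rho_bounds by (subst integral_nonneg_eq_0_iff_AE[symmetric]) auto
    then have "?C = (\<integral>w. 0 \<partial>P0j D j)"
      unfolding cross_cov_eq[OF sq_integrable_rho_f sq_integrable_rhoV]
      using integrable_outer[OF sq_integrable_rho_f
          sq_integrable_diff[OF sq_integrable_rhoV sq_integrable_const]]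
      by (intro integral_cong_AE) (auto simp: outer.zero_left)
    then have "?C = 0" by simp
    then show ?thesis
      by (simp add: coef matrix_matrix_mult_def vec_eq_iff)
  qed
qed

text \<open>Isolates the additive constant, which covariances ignore; it is written as an added
  negative to match \<open>cov_mat_add_const\<close>.\<close>

lemma Qsc_eq:
  assumes "v \<in> src D j"
  shows "Qsc D f j v = Qsc_coef D f j *v (rho D j v *\<^sub>R v)
    + - (Qsc_coef D f j *v (\<integral>w. rhoV D j w \<partial>P0j D j))"
  using assms by (simp add: Qsc_def Qsc_coef_def Let_def matrix_vector_mult_diff_distrib)

lemma Qsc_measurable: "(\<lambda>w. Qsc D f j (Vof D w)) \<in> borel_measurable (P0j D j)"
proof -
  have V: "Vof D \<in> borel_measurable (P0j D j)"
    unfolding measurable_P0j by (rule Vof_measurable[OF D])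
  have src: "src D j \<in> sets borel" using sampling_modelD(5)[OF D] by blast
  have coef: "(\<lambda>x. Qsc_coef D f j *v x) \<in> borel_measurable borel"
    by (rule borel_measurable_continuous_onI[OF linear_continuous_on[OF matrix_vector_mul_bounded_linear]])
  have ind: "(\<lambda>w. indicator (src D j) (Vof D w) :: real) \<in> borel_measurable (P0j D j)"
    by (rule measurable_compose[OF V borel_measurable_indicator[OF src]])
  have "(\<lambda>w. Qsc_coef D f j *v (rhoV D j w - (\<integral>w. rhoV D j w \<partial>P0j D j))) \<in> borel_measurable (P0j D j)"
    by (rule measurable_compose[OF borel_measurable_diff[OF rhoV_measurable borel_measurable_const] coef])
  from borel_measurable_scaleR[OF ind this]
  show ?thesis unfolding Qsc_def Qsc_coef_def Let_def rhoV_def .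
qed

text \<open>The conditional law is concentrated on the source, so the indicator is almost surely 1
  and \<open>Qsc\<close> differs from the linear map by a constant only.\<close>

lemma cov_mat_Qsc:
  "cov_mat (P0j D j) (\<lambda>w. Qsc D f j (Vof D w))
    = cov_mat (P0j D j) (\<lambda>w. Qsc_coef D f j *v rhoV D j w)" (is ?Q)
  "cov_mat (P0j D j) (\<lambda>w. rho D j (Vof D w) *\<^sub>R f (fst w) - Qsc D f j (Vof D w))
    = cov_mat (P0j D j) (\<lambda>w. rho D j (Vof D w) *\<^sub>R f (fst w) - Qsc_coef D f j *v rhoV D j w)" (is ?R)
proof -
  interpret prob_space "P0j D j" by (rule prob_space_P0j)
  let ?q = "\<lambda>w. Qsc_coef D f j *v rhoV D j w" and ?g = "\<lambda>w. rho D j (Vof D w) *\<^sub>R f (fst w)"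
  let ?c = "Qsc_coef D f j *v (\<integral>w. rhoV D j w \<partial>P0j D j)"
  have q: "sq_integrable (P0j D j) ?q" by (rule sq_integrable_matrix[OF sq_integrable_rhoV])
  have r: "sq_integrable (P0j D j) (\<lambda>w. ?g w - ?q w)"
    by (rule sq_integrable_diff[OF sq_integrable_rho_f q])
  have [measurable]: "?q \<in> borel_measurable (P0j D j)" "?g \<in> borel_measurable (P0j D j)"
    using q sq_integrable_rho_f by (simp_all add: sq_integrable_def)
  note Qsc_measurable[measurable]
  have AE: "AE w in P0j D j. Qsc D f j (Vof D w) = ?q w + - ?c"
    using AE_P0j_in_src by eventually_elim (simp add: Qsc_eq rhoV_def)
  then have "cov_mat (P0j D j) (\<lambda>w. Qsc D f j (Vof D w)) = cov_mat (P0j D j) (\<lambda>w. ?q w + - ?c)"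
    by (intro cov_mat_cong_AE) measurable
  then show ?Q by (simp only: cov_mat_add_const[OF q])
  have "cov_mat (P0j D j) (\<lambda>w. ?g w - Qsc D f j (Vof D w))
      = cov_mat (P0j D j) (\<lambda>w. ?g w - ?q w + ?c)"
    by (rule cov_mat_cong_AE) (use AE in \<open>auto elim!: eventually_mono\<close>)
  then show ?R by (simp only: cov_mat_add_const[OF r])
qed

text \<open>This is \<open>cov_mat_regression\<close> with \<open>matrix L\<close> as competing
  slope; the excess over the optimum depends only on the difference of the slopes.\<close>

lemma cov_mat_source_decomposition:
  assumes L: "linear L"
  shows "cov_mat (P0j D j) (\<lambda>w. rho D j (Vof D w) *\<^sub>R f (fst w) - L (rho D j (Vof D w) *\<^sub>R Vof D w))
    = cov_mat (P0j D j) (\<lambda>w. rho D j (Vof D w) *\<^sub>R f (fst w) - Qsc D f j (Vof D w))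
      + cov_mat (P0j D j) (\<lambda>w. (Qsc_coef D f j - matrix L) *v rhoV D j w)"
  unfolding cov_mat_Qsc(2)
  using prob_space.cov_mat_regression[OF prob_space_P0j sq_integrable_rho_f sq_integrable_rhoV
      Qsc_coef_normal_equation, of "matrix L"]
  by (simp only: matrix_vector_mul(2)[OF L, THEN fun_cong] rhoV_def[symmetric])

lemma pos_semidef_cov_mat_source:
  "pos_semidef (cov_mat (P0j D j) (\<lambda>w. A *v rhoV D j w))"
  by (rule prob_space.pos_semidef_cov_mat[OF prob_space_P0j
        sq_integrable_matrix[OF sq_integrable_rhoV]])

end

section \<open>Summation over the sources: optimality and the variance reduction\<close>

theorem theorem4p2:
  fixes D :: "('w, 'x, 'c::finite, 'u::finite, 'j::finite) merged"
    and G :: "real \<Rightarrow> real"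
    and \<alpha> :: "nat \<Rightarrow> 'j \<Rightarrow> 'w \<Rightarrow> real^('c + 'u)"
    and \<beta> :: "nat \<Rightarrow> 'w \<Rightarrow> real^('c + 'u)"
    and f :: "'x \<Rightarrow> real^'d"
  assumes "sampling_model D"
    and "weight_function D"
    and "calibration_assumptions D G \<alpha> \<beta>"
    and "f \<in> borel_measurable (Xsp D)"
    and "integrable (P0 D) (\<lambda>x. outer (f x) (f x))"
    and AV_H: "has_asymp_var (Om D) (rootn_err (PH D (f \<circ> fst)) (\<integral>x. f x \<partial>P0 D))
                 (AV_form D f (\<lambda>j v. 0))"
    and AV_sc: "has_asymp_var (Om D) (rootn_err (PHsc D G \<alpha> f) (\<integral>x. f x \<partial>P0 D))
                  (AV_form D f (Qsc D f))"
  shows "PHsc D G \<alpha> f \<in> class_C D f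
    \<and> (\<forall>T\<in>class_C D f.
         loewner_le (AV (Om D) (rootn_err (PHsc D G \<alpha> f) (\<integral>x. f x \<partial>P0 D)))
                    (AV (Om D) (rootn_err T (\<integral>x. f x \<partial>P0 D))))
    \<and> AV (Om D) (rootn_err (PHsc D G \<alpha> f) (\<integral>x. f x \<partial>P0 D))
        = AV (Om D) (rootn_err (PH D (f \<circ> fst)) (\<integral>x. f x \<partial>P0 D))
          - (\<Sum>j\<in>UNIV. AV_coef D j *\<^sub>R cov_mat (P0j D j) (\<lambda>w. Qsc D f j (Vof D w)))"
proof -
  note source = assms(1-5)
  \<comment> \<open>All three claims are instances: \<open>L\<close> equal to the slopes of
    \<open>Qsc\<close> gives membership in the class, arbitrary \<open>L\<close> gives optimality,
    and \<open>L\<close> equal to 0 gives the reduction.\<close>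
  have decomp: "AV_form D f (\<lambda>j v. L j (rho D j v *\<^sub>R v)) = AV_form D f (Qsc D f)
      + (\<Sum>j\<in>UNIV. AV_coef D j *\<^sub>R
          cov_mat (P0j D j) (\<lambda>w. (Qsc_coef D f j - matrix (L j)) *v rhoV D j w))"
    if "\<And>j. linear (L j)" for L
  proof -
    have "AV_coef D j *\<^sub>R cov_mat (P0j D j)
          (\<lambda>w. rho D j (Vof D w) *\<^sub>R f (fst w) - L j (rho D j (Vof D w) *\<^sub>R Vof D w))
        = AV_coef D j *\<^sub>R cov_mat (P0j D j)
            (\<lambda>w. rho D j (Vof D w) *\<^sub>R f (fst w) - Qsc D f j (Vof D w))
          + AV_coef D j *\<^sub>R cov_mat (P0j D j)
            (\<lambda>w. (Qsc_coef D f j - matrix (L j)) *v rhoV D j w)" for j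
    \<comment> \<open>The single-source results need positive mass; a null source has coefficient
      0.\<close>
    proof (cases "nu D j = 0")
      case True
      then show ?thesis by (simp add: AV_coef_eq_0)
    next
      case False
      show ?thesis
        unfolding cov_mat_source_decomposition[OF source False that] by (rule scaleR_add_right)
    qed
    then show ?thesis by (simp add: AV_form_def sum.distrib)
  qed
  have AV_sc_eq: "AV (Om D) (rootn_err (PHsc D G \<alpha> f) (\<integral>x. f x \<partial>P0 D)) = AV_form D f (Qsc D f)"
    by (rule AV_eq[OF AV_sc])
  have cov_0: "cov_mat (P0j D j) (\<lambda>w. 0 :: real^'d) = 0" for j
    by (simp add: cov_mat_def outer.zero_left)
  have zero_form: "AV_form D f (\<lambda>j v. 0) = AV_form D f (Qsc D f)
      + (\<Sum>j\<in>UNIV. AV_coef D j *\<^sub>R cov_mat (P0j D j) (\<lambda>w. Qsc D f j (Vof D w)))"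
  proof -
    have "AV_coef D j *\<^sub>R cov_mat (P0j D j) (\<lambda>w. Qsc_coef D f j *v rhoV D j w)
        = AV_coef D j *\<^sub>R cov_mat (P0j D j) (\<lambda>w. Qsc D f j (Vof D w))" for j
      by (cases "nu D j = 0") (simp_all add: AV_coef_eq_0 cov_mat_Qsc(1)[OF source])
    \<comment> \<open>With zero slopes the excess is the covariance of the whole projection.\<close>
    moreover have "matrix (\<lambda>_. 0) = (0 :: real^('c + 'u)^'d)"
      by (simp add: matrix_def vec_eq_iff)
    ultimately show ?thesis
      using decomp[of "\<lambda>_ _. 0"] by (simp add: linear_zero del: scaleR_cancel_left)
  qed
  have "PHsc D G \<alpha> f \<in> class_C D f"
  proof -
    \<comment> \<open>\<open>Qsc\<close> is not itself homogeneous linear, but its slopes are, and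
      with them the excess is the covariance of 0.\<close>
    have "AV_form D f (\<lambda>j v. Qsc_coef D f j *v (rho D j v *\<^sub>R v)) = AV_form D f (Qsc D f)"
      using decomp[of "\<lambda>j. (*v) (Qsc_coef D f j)"] cov_0
      by (simp add: matrix_of_matrix_vector_mul)
    then show ?thesis
      unfolding class_C_def using AV_sc by (auto intro!: exI[of _ "\<lambda>j. (*v) (Qsc_coef D f j)"])
  qed
  moreover have "loewner_le (AV (Om D) (rootn_err (PHsc D G \<alpha> f) (\<integral>x. f x \<partial>P0 D)))
      (AV (Om D) (rootn_err T (\<integral>x. f x \<partial>P0 D)))" if T_in: "T \<in> class_C D f" for T
  proof -
    obtain L where lin: "\<forall>j. linear (L j)"
      and T: "has_asymp_var (Om D) (rootn_err T (\<integral>x. f x \<partial>P0 D))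
        (AV_form D f (\<lambda>j v. L j (rho D j v *\<^sub>R v)))"
      using T_in[unfolded class_C_def mem_Collect_eq] by (elim exE conjE)
    have L: "linear (L j)" for j using lin by (rule spec)
    have "pos_semidef (AV_coef D j *\<^sub>R
        cov_mat (P0j D j) (\<lambda>w. (Qsc_coef D f j - matrix (L j)) *v rhoV D j w))" for j
    proof (cases "nu D j = 0")
      case True
      then show ?thesis by (simp add: AV_coef_eq_0 pos_semidef_0)
    next
      case False
      then show ?thesis
        by (intro pos_semidef_scaleR[OF AV_coef_nonneg[OF assms(1)]]
            pos_semidef_cov_mat_source[OF source])
    qed
    \<comment> \<open>The difference of the two asymptotic variances is exactly this sum of positive
      semidefinite matrices.\<close>
    then show ?thesis
      unfolding loewner_le_def AV_sc_eq AV_eq[OF T] decomp[OF L] by (simp add: pos_semidef_sum)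
  qed
  ultimately show ?thesis by (simp add: AV_sc_eq AV_eq[OF AV_H] zero_form)
qed

end
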